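(* For every integer $k \ge 5$ there exists a constant $c = c(k) > 0$, depending only on $k$, such that for every integer $n \ge k$, $$g_k(n) > 2^{c n^{k-4}}.$$
   Context: A $k$-uniform hypergraph $H$ consists of a finite vertex set $V$ and a set of edges, each of which is a $k$-element subset of $V$. A set $S \subset V$ induces (spans) exactly those edges of $H$ that are contained in $S$. An independent set of $H$ is a subset of $V$ that contains no edge of $H$. For integers $n \ge k \ge 5$, $g_k(n)$ denotes the minimum integer $N$ such that any $k$-uniform hypergraph on $N$ vertices with the property that every set of $k+1$ vertices induces 0, 2, or 4 edges contains an independent set of size $n$. *)

theory Defs
  imports Complex_Main "HOL-Library.Ramsey"
begin

definition uniform_hypergraph :: "nat \<Rightarrow> 'a set \<Rightarrow> 'a set set \<Rightarrow> bool" where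
  "uniform_hypergraph k V E \<longleftrightarrow> finite V \<and> E \<subseteq> nsets V k"

definition induced_edges :: "'a set set \<Rightarrow> 'a set \<Rightarrow> 'a set set" where
  "induced_edges E S = {e \<in> E. e \<subseteq> S}"

definition independent_set :: "'a set \<Rightarrow> 'a set set \<Rightarrow> 'a set \<Rightarrow> bool" where
  "independent_set V E I \<longleftrightarrow> I \<subseteq> V \<and> induced_edges E I = {}"

definition spans_0_2_4 :: "nat \<Rightarrow> 'a set \<Rightarrow> 'a set set \<Rightarrow> bool" where
  "spans_0_2_4 k V E \<longleftrightarrow> (\<forall>S \<in> nsets V (k + 1). card (induced_edges E S) \<in> {0, 2, 4})"

text \<open>Every finite hypergraph is isomorphic to one whose vertices are natural numbers, so
  quantifying over vertex sets of type \<^typ>\<open>nat set\<close> loses no generality.\<close>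

definition forces_independent :: "nat \<Rightarrow> nat \<Rightarrow> nat \<Rightarrow> bool" where
  "forces_independent k n N \<longleftrightarrow>
     (\<forall>(V :: nat set) E. uniform_hypergraph k V E \<and> card V = N \<and> spans_0_2_4 k V E
        \<longrightarrow> (\<exists>I. independent_set V E I \<and> card I = n))"

definition ramsey_g :: "nat \<Rightarrow> nat \<Rightarrow> nat" where
  "ramsey_g k n = (LEAST N. forces_independent k n N)"

text \<open>For \<open>k \<ge> 5\<close> the minimum is attained, so the \<open>LEAST\<close> above is never unspecified: by Ramsey's
  theorem a large hypergraph has an independent set of size \<open>n\<close> or \<open>k + 1\<close> vertices spanning all
  \<open>k + 1 \<ge> 6\<close> possible edges.\<close>

lemma forces_independent_exists:
  assumes "k \<ge> 5"
  shows "\<exists>N. forces_independent k n N"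
proof -
  obtain N :: nat where N: "partn_lst {..<N} [k + 1, n] k"
    using ramsey_full by blast
  have "\<exists>I. independent_set V E I \<and> card I = n"
    if H: "uniform_hypergraph k V E" and card: "card V = N" and sp: "spans_0_2_4 k V E"
    for V :: "nat set" and E
  proof -
    have fin: "finite V" and E: "E \<subseteq> nsets V k"
      using H by (auto simp: uniform_hypergraph_def)
    obtain h where h: "bij_betw h {..<N} V"
      using ex_bij_betw_nat_finite[OF fin] card by (auto simp: atLeast0LessThan)
    have inj: "inj_on h {..<N}" and img: "h ` {..<N} = V"
      using h by (auto simp: bij_betw_def)
    define f where "f X = (if h ` X \<in> E then 0 else 1 :: nat)" for X
    have "f \<in> nsets {..<N} k \<rightarrow> {..<2}"
      by (auto simp: f_def)
    then obtain i H where "i < length [k + 1, n]" and Hn: "H \<in> nsets {..<N} ([k + 1, n] ! i)"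
      and mono: "f ` nsets H k \<subseteq> {i}"
      by (rule partn_lstE[OF N]) simp_all
    then have i: "i < 2"
      by simp
    have HN: "H \<subseteq> {..<N}"
      using Hn by (auto simp: nsets_def)
    define I where "I = h ` H"
    have IV: "I \<subseteq> V"
      using HN img by (auto simp: I_def)
    have cI: "card I = [k + 1, n] ! i"
      using Hn card_image[OF inj_on_subset[OF inj HN]] by (auto simp: I_def nsets_def)
    have finI: "finite I"
      using IV fin finite_subset by blast
    have col: "(e \<in> E) = (i = 0)" if "e \<in> nsets I k" for e
    proof -
      have "e \<in> nsets (h ` H) k"
        using that by (simp add: I_def)
      then obtain X where X: "X \<in> nsets H k" and eX: "e = h ` X"
        by (rule nset_image_obtains[OF _ inj_on_subset[OF inj HN]])
      have "f X = i"
        using mono X by blast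
      then show ?thesis
        unfolding eX f_def by (metis zero_neq_one)
    qed
    consider "i = 0" | "i = 1"
      using i by linarith
    then show ?thesis
    proof cases
      case 1
      then have "induced_edges E I = nsets I k"
        using col E by (auto simp: induced_edges_def nsets_def)
      then have "card (induced_edges E I) = k + 1"
        using cI 1 by simp
      moreover have "I \<in> nsets V (k + 1)"
        using IV finI cI 1 by (auto simp: nsets_def)
      ultimately have "k + 1 \<in> {0, 2, 4}"
        using sp unfolding spans_0_2_4_def by metis
      then show ?thesis
        using assms by simp
    next
      case 2
      then have "induced_edges E I = {}"
        using col E by (auto simp: induced_edges_def nsets_def)
      then show ?thesis
        using IV cI 2 by (auto simp: independent_set_def)
    qed
  qed
  then show ?thesis
    unfolding forces_independent_def by blast
qed

end

theory Submission
  imports Defs "HOL-Library.Disjoint_Sets"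
begin

text \<open>The hypergraph is a random coboundary. For each \<open>(k - 3)\<close>-set \<open>F\<close> of vertices choose a random
  labelling of the elements of \<open>F\<close> by \<open>k - 1\<close> labels. Call a \<open>(k - 1)\<close>-set \<open>g\<close> coherent if the
  labellings of all \<open>F \<subseteq> g\<close> are restrictions of a single bijective labelling of \<open>g\<close>, and let the
  edges be the \<open>k\<close>-sets that contain an odd number of coherent sets.
  
  Let \<open>S\<close> be a set of \<open>k + 1\<close> vertices. A coherent set inside \<open>S\<close> lies in exactly two \<open>k\<close>-subsets of
  \<open>S\<close>, so \<open>S\<close> spans an even number of edges (\<open>even_card_odd_facets\<close>). To see that this number is at
  most 4 (\<open>card_odd_facets_le_4\<close>), note that two coherent sets in \<open>S\<close> have at least \<open>k - 3\<close> common
  elements, and so their labellings agree wherever both are defined. Hence one labelling of \<open>S\<close> by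
  \<open>k - 1\<close> labels is bijective on every coherent set. As \<open>S\<close> has only two elements more than there are
  labels, at most 4 elements of \<open>S\<close> share their label with another one, and an element whose label is
  unique lies in every coherent set; removing it leaves no coherent set, and so no edge.
  
  For a fixed \<open>n\<close>-set \<open>I\<close>, whether a \<open>k\<close>-set is an edge depends only on the labellings of its
  \<open>(k - 3)\<close>-subsets, and some pattern of labels makes it an edge (\<open>odd_pattern_exists\<close>). The
  set \<open>I\<close> contains at least \<open>a * n ^ (k - 3)\<close> \<open>k\<close>-sets that pairwise share fewer than \<open>k - 3\<close> elements
  (\<open>packing_size\<close>), for some \<open>a > 0\<close> that depends only on \<open>k\<close>. They are edges independently of each
  other, so \<open>I\<close> is independent with probability at most \<open>exp (- b * n ^ (k - 3))\<close>. There are at most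
  \<open>N ^ n\<close> sets \<open>I\<close>, and the union bound leaves a labelling without independent \<open>n\<close>-sets as long as
  \<open>N \<le> 2 powr (b * n ^ (k - 4))\<close>. Probabilities are written as counts of labellings.\<close>

section \<open>Coherent sets and their coboundary\<close>

text \<open>A labelling of every \<open>r\<close>-subset of \<open>V\<close> is encoded as one function on the pairs of an \<open>r\<close>-set and an
  element of it. All coordinates then have the same range of \<open>k - 1\<close> labels, which makes the later
  counting uniform.\<close>

definition incidences :: "nat \<Rightarrow> 'a set \<Rightarrow> ('a set \<times> 'a) set" where
  "incidences r V = (SIGMA F:nsets V r. F)"

definition coherent :: "nat \<Rightarrow> ('a set \<times> 'a \<Rightarrow> nat) \<Rightarrow> 'a set \<Rightarrow> bool" where
  "coherent k c g \<longleftrightarrow>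
     (\<exists>l. bij_betw l g {..<k - 1} \<and> (\<forall>(F, x) \<in> incidences (k - 3) g. c (F, x) = l x))"

definition coherent_subsets :: "nat \<Rightarrow> ('a set \<times> 'a \<Rightarrow> nat) \<Rightarrow> 'a set \<Rightarrow> 'a set set" where
  "coherent_subsets k c e = {g \<in> nsets e (k - 1). coherent k c g}"

definition coboundary :: "nat \<Rightarrow> 'a set \<Rightarrow> ('a set \<times> 'a \<Rightarrow> nat) \<Rightarrow> 'a set set" where
  "coboundary k V c = {e \<in> nsets V k. odd (card (coherent_subsets k c e))}"

lemma finite_incidences: "finite V \<Longrightarrow> finite (incidences r V)"
  unfolding incidences_def
  by (intro finite_SigmaI finite_imp_finite_nsets) (auto simp: nsets_def)

lemma card_incidences:
  assumes "finite V"
  shows "card (incidences r V) = (card V choose r) * r"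
proof -
  have "card (incidences r V) = (\<Sum>F\<in>nsets V r. card F)"
    unfolding incidences_def using assms
    by (intro card_SigmaI finite_imp_finite_nsets) (auto simp: nsets_def)
  also have "\<dots> = (\<Sum>F\<in>nsets V r. r)"
    by (rule sum.cong) (auto simp: nsets_def)
  finally show ?thesis
    by simp
qed

lemma finite_coherent_subsets: "finite e \<Longrightarrow> finite (coherent_subsets k c e)"
  unfolding coherent_subsets_def by (simp add: finite_imp_finite_nsets)

section \<open>Every set of \<open>k + 1\<close> vertices spans 0, 2 or 4 edges\<close>

text \<open>This is the statement that a coboundary is a cocycle modulo 2: count the pairs of a coherent set
  \<open>g \<subseteq> S\<close> and a vertex \<open>v \<in> S\<close> outside \<open>g\<close>. Each \<open>g\<close> is counted twice.\<close>

lemma even_card_odd_facets: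
  assumes S: "finite S" "card S = k + 1" and k: "k \<ge> 1"
  shows "even (card {v \<in> S. odd (card (coherent_subsets k c (S - {v})))})"
proof -
  let ?P = "coherent_subsets k c S"
  have fin: "finite ?P"
    using S by (simp add: finite_coherent_subsets)
  have two: "card {v \<in> S. v \<notin> g} = 2" if "g \<in> ?P" for g
  proof -
    have g: "g \<subseteq> S" "card g = k - 1" "finite g"
      using that by (auto simp: coherent_subsets_def nsets_def)
    have "{v \<in> S. v \<notin> g} = S - g"
      by auto
    then show ?thesis
      using g S k by (simp add: card_Diff_subset)
  qed
  have sub: "coherent_subsets k c (S - {v}) = {g \<in> ?P. v \<notin> g}" for v
    by (auto simp: coherent_subsets_def nsets_def)
  have "(\<Sum>v\<in>S. card (coherent_subsets k c (S - {v})))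
      = (\<Sum>v\<in>S. \<Sum>g\<in>?P. if v \<notin> g then 1 else 0)"
    unfolding sub using fin by (simp add: sum.If_cases Int_def)
  also have "\<dots> = (\<Sum>g\<in>?P. \<Sum>v\<in>S. if v \<notin> g then 1 else 0)"
    by (rule sum.swap)
  also have "\<dots> = (\<Sum>g\<in>?P. card {v \<in> S. v \<notin> g})"
    using S by (simp add: sum.If_cases Int_def)
  also have "\<dots> = (\<Sum>g\<in>?P. 2)"
    using two by (intro sum.cong) auto
  finally have "even (\<Sum>v\<in>S. card (coherent_subsets k c (S - {v})))"
    by simp
  then show ?thesis
    using S by (simp add: even_sum_iff)
qed

text \<open>Every common element lies in a common \<open>(k - 3)\<close>-subset, whose labelling both \<open>l\<close> and \<open>l'\<close> extend.\<close>

lemma coherent_labels_agree: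
  assumes k: "k \<ge> 4" and fin: "finite g" "finite g'" and big: "card (g \<inter> g') \<ge> k - 3"
    and l: "\<forall>(F, x) \<in> incidences (k - 3) g. c (F, x) = l x"
    and l': "\<forall>(F, x) \<in> incidences (k - 3) g'. c (F, x) = l' x"
    and x: "x \<in> g" "x \<in> g'"
  shows "l x = l' x"
proof -
  have "k - 4 \<le> card (g \<inter> g' - {x})"
    using big x fin by (simp add: card_Diff_singleton)
  then obtain F where F: "F \<subseteq> g \<inter> g' - {x}" "card F = k - 4" "finite F"
    by (rule obtain_subset_with_card_n)
  have "card (insert x F) = k - 3"
    using F k by (subst card_insert_disjoint) auto
  then have "(insert x F, x) \<in> incidences (k - 3) g" "(insert x F, x) \<in> incidences (k - 3) g'"
    using F x by (auto simp: incidences_def nsets_def)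
  then have "c (insert x F, x) = l x" "c (insert x F, x) = l' x"
    using l l' by auto
  then show ?thesis
    by simp
qed

text \<open>A vertex whose removal leaves an odd number of coherent sets is missed by some coherent set \<open>g\<close>. In
  the common labelling \<open>m\<close> of \<open>S\<close> its label occurs again in \<open>g\<close>. If \<open>a\<close> and \<open>b\<close> are the two vertices
  outside one coherent set \<open>g0\<close>, the only vertices with a repeated label are \<open>a\<close>, \<open>b\<close> and the elements
  of \<open>g0\<close> that have the labels of \<open>a\<close> and \<open>b\<close>.\<close>

lemma card_odd_facets_le_4:
  assumes S: "finite S" "card S = k + 1" and k: "k \<ge> 4"
  shows "card {v \<in> S. odd (card (coherent_subsets k c (S - {v})))} \<le> 4"
proof -
  let ?P = "coherent_subsets k c S"
  let ?O = "{v \<in> S. odd (card (coherent_subsets k c (S - {v})))}"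
  have odd_missed: "\<exists>g\<in>?P. v \<notin> g" if "v \<in> ?O" for v
  proof -
    have "coherent_subsets k c (S - {v}) \<noteq> {}"
      using that by force
    then show ?thesis
      by (auto simp: coherent_subsets_def nsets_def)
  qed
  show ?thesis
  proof (cases "?P = {}")
    case True
    then have "?O = {}"
      using odd_missed by blast
    then show ?thesis
      by (metis card.empty zero_le)
  next
    case False
    then obtain g0 where g0: "g0 \<in> ?P"
      by blast
    have P: "g \<subseteq> S" "finite g" "card g = k - 1" if "g \<in> ?P" for g
      using that by (auto simp: coherent_subsets_def nsets_def)
    have "\<forall>g\<in>?P. \<exists>l. bij_betw l g {..<k - 1} \<and> (\<forall>(F, x) \<in> incidences (k - 3) g. c (F, x) = l x)"
      by (simp add: coherent_subsets_def coherent_def)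
    from bchoice[OF this] obtain l where bij: "\<And>g. g \<in> ?P \<Longrightarrow> bij_betw (l g) g {..<k - 1}"
      and lab: "\<And>g. g \<in> ?P \<Longrightarrow> \<forall>(F, x) \<in> incidences (k - 3) g. c (F, x) = l g x"
      by blast
    have agree: "l g x = l g' x" if g: "g \<in> ?P" "g' \<in> ?P" and x: "x \<in> g" "x \<in> g'" for g g' x
    proof -
      have "card (g \<union> g') \<le> k + 1"
        using P[OF g(1)] P[OF g(2)] S by (metis Un_least card_mono)
      moreover have "card g + card g' = card (g \<union> g') + card (g \<inter> g')"
        using P g by (intro card_Un_Int) auto
      ultimately have "card (g \<inter> g') \<ge> k - 3"
        using P g by simp
      then show ?thesis
        using coherent_labels_agree[OF k P(2)[OF g(1)] P(2)[OF g(2)] _ lab[OF g(1)] lab[OF g(2)] x]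
        by simp
    qed
    \<comment> \<open>A vertex in no coherent set receives an arbitrary label; it must be below \<open>k - 1\<close> so that
      this label, too, occurs in every coherent set.\<close>
    define m where "m x = (if \<exists>g\<in>?P. x \<in> g then l (SOME g. g \<in> ?P \<and> x \<in> g) x else 0)" for x
    have m: "m x = l g x" if "g \<in> ?P" "x \<in> g" for g x
    proof -
      let ?g = "SOME g. g \<in> ?P \<and> x \<in> g"
      have "?g \<in> ?P \<and> x \<in> ?g"
        by (rule someI[of _ g]) (use that in blast)
      then have "l ?g x = l g x"
        using agree that by blast
      then show ?thesis
        unfolding m_def using that by (subst if_P) blast+
    qed
    have m_bij: "bij_betw m g {..<k - 1}" if "g \<in> ?P" for g
      using bij[OF that] m[OF that] by (metis bij_betw_cong)
    have m_lt: "m x < k - 1" for x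
    proof (cases "\<exists>g\<in>?P. x \<in> g")
      case True
      then show ?thesis
        using m_bij by (metis bij_betwE lessThan_iff)
    next
      case False
      then show ?thesis
        using k by (simp add: m_def)
    qed
    have twin: "\<exists>y\<in>g. m y = m x" if "g \<in> ?P" for g x
      using m_bij[OF that] m_lt[of x] unfolding bij_betw_def by (metis imageE lessThan_iff)
    have "card (S - g0) = 2"
      using P[OF g0] S k by (simp add: card_Diff_subset)
    then obtain a b where ab: "S - g0 = {a, b}"
      by (auto simp: card_2_iff)
    obtain a' b' where a'b': "a' \<in> g0" "m a' = m a" "b' \<in> g0" "m b' = m b"
      using twin[OF g0] by metis
    have "?O \<subseteq> {a, b, a', b'}"
    proof
      fix v assume v: "v \<in> ?O"
      then obtain g where g: "g \<in> ?P" "v \<notin> g"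
        using odd_missed by blast
      then obtain y where y: "y \<in> g" "m y = m v"
        using twin by blast
      show "v \<in> {a, b, a', b'}"
      proof (cases "v \<in> g0")
        case True
        have inj: "inj_on m g0"
          using m_bij[OF g0] by (simp add: bij_betw_def)
        then have "y \<notin> g0"
          using y g True by (metis inj_onD)
        then have "y \<in> {a, b}"
          using ab P(1)[OF g(1)] y by blast
        then show ?thesis
          using inj y True a'b' by (auto simp: inj_on_def)
      next
        case False
        then show ?thesis
          using v ab by blast
      qed
    qed
    then have "card ?O \<le> card {a, b, a', b'}"
      by (rule card_mono[rotated]) simp
    also have "\<dots> \<le> 4"
      by (simp add: card_insert_if)
    finally show ?thesis .
  qed
qed

lemma spans_0_2_4_coboundary:
  assumes k: "k \<ge> 4"
  shows "spans_0_2_4 k V (coboundary k V c)"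
  unfolding spans_0_2_4_def
proof
  fix S assume "S \<in> nsets V (k + 1)"
  then have S: "S \<subseteq> V" "finite S" "card S = k + 1"
    by (auto simp: nsets_def)
  let ?O = "{v \<in> S. odd (card (coherent_subsets k c (S - {v})))}"
  have "induced_edges (coboundary k V c) S = (\<lambda>v. S - {v}) ` ?O"
  proof (intro set_eqI iffI)
    fix e assume "e \<in> induced_edges (coboundary k V c) S"
    then have e: "e \<subseteq> S" "card e = k" "finite e" "odd (card (coherent_subsets k c e))"
      by (auto simp: induced_edges_def coboundary_def nsets_def)
    then have "card (S - e) = 1"
      using S by (simp add: card_Diff_subset)
    then obtain v where "S - e = {v}"
      by (auto simp: card_1_singleton_iff)
    then have "e = S - {v}" "v \<in> S"
      using e by blast+
    then show "e \<in> (\<lambda>v. S - {v}) ` ?O"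
      using e by blast
  next
    fix e assume "e \<in> (\<lambda>v. S - {v}) ` ?O"
    then show "e \<in> induced_edges (coboundary k V c) S"
      using S by (auto simp: induced_edges_def coboundary_def nsets_def)
  qed
  moreover have "inj_on (\<lambda>v. S - {v}) ?O"
    by (auto simp: inj_on_def)
  ultimately have card: "card (induced_edges (coboundary k V c) S) = card ?O"
    by (simp add: card_image)
  have "even (card ?O)" "card ?O \<le> 4"
    using even_card_odd_facets[of S k c] card_odd_facets_le_4[of S k c] S k by auto
  then show "card (induced_edges (coboundary k V c) S) \<in> {0, 2, 4}"
    unfolding card by (auto elim!: evenE)
qed

section \<open>Independent sets are unlikely\<close>

text \<open>The pattern makes \<open>K - {v}\<close> the only coherent subset of \<open>K\<close>: the sets \<open>F\<close> that avoid \<open>v\<close> carry the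
  restrictions of one bijective labelling, and the sets that contain \<open>v\<close> are labelled constantly 0.
  As \<open>k \<ge> 5\<close>, the latter have at least two elements, so no injective labelling extends them.\<close>

lemma odd_pattern_exists:
  assumes K: "finite K" "card K = k" and k: "k \<ge> 5"
  obtains w where "w \<in> incidences (k - 3) K \<rightarrow>\<^sub>E {..<k - 1}"
    and "\<And>c. (\<forall>i \<in> incidences (k - 3) K. c i = w i) \<Longrightarrow> odd (card (coherent_subsets k c K))"
proof -
  obtain v where v: "v \<in> K"
    using K k by (metis card.empty ex_in_conv not_numeral_le_zero)
  have cardKv: "card (K - {v}) = k - 1"
    using K v by simp
  then obtain l where l: "bij_betw l (K - {v}) {..<k - 1}"
    using K by (metis atLeast0LessThan ex_bij_betw_finite_nat finite_Diff)
  define w where "w = restrict (\<lambda>(F, x). if v \<in> F then 0 else l x) (incidences (k - 3) K)"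
  have w_range: "w \<in> incidences (k - 3) K \<rightarrow>\<^sub>E {..<k - 1}"
    using l k unfolding w_def bij_betw_def by (fastforce simp: incidences_def nsets_def)
  have "coherent_subsets k c K = {K - {v}}" if c: "\<forall>i \<in> incidences (k - 3) K. c i = w i" for c
  proof (intro equalityI subsetI)
    fix g assume "g \<in> coherent_subsets k c K"
    then have g: "g \<subseteq> K" "finite g" "card g = k - 1" and "coherent k c g"
      by (auto simp: coherent_subsets_def nsets_def)
    then obtain m where m: "bij_betw m g {..<k - 1}"
      "\<forall>(F, x) \<in> incidences (k - 3) g. c (F, x) = m x"
      by (auto simp: coherent_def)
    have "v \<notin> g"
    proof
      assume vg: "v \<in> g"
      have "k - 4 \<le> card (g - {v})"
        using g vg by simp
      then obtain F where F: "F \<subseteq> g - {v}" "card F = k - 4" "finite F"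
        by (rule obtain_subset_with_card_n)
      have "F \<noteq> {}"
        using F k by auto
      then obtain x where x: "x \<in> F"
        by blast
      have "card (insert v F) = k - 3"
        using F k by (subst card_insert_disjoint) auto
      then have I: "(insert v F, y) \<in> incidences (k - 3) g" "(insert v F, y) \<in> incidences (k - 3) K"
        if "y \<in> insert v F" for y
        using F g that vg by (auto simp: incidences_def nsets_def)
      have "m y = 0" if "y \<in> insert v F" for y
        using m(2) c I[OF that] by (fastforce simp: w_def)
      then have "m v = m x"
        using x by simp
      then show False
        using m(1) vg x F unfolding bij_betw_def inj_on_def by blast
    qed
    then have "g = K - {v}"
      using g K cardKv by (intro card_subset_eq) auto
    then show "g \<in> {K - {v}}"
      by simp
  next
    fix g assume "g \<in> {K - {v}}"
    then have g: "g = K - {v}"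
      by simp
    have "c (F, x) = l x" if "(F, x) \<in> incidences (k - 3) g" for F x
    proof -
      have "(F, x) \<in> incidences (k - 3) K" "v \<notin> F"
        using that g by (auto simp: incidences_def nsets_def)
      then show ?thesis
        using c by (simp add: w_def)
    qed
    then have "coherent k c g"
      unfolding coherent_def using l g by blast
    then show "g \<in> coherent_subsets k c K"
      using g cardKv K by (simp add: coherent_subsets_def nsets_def)
  qed
  then show ?thesis
    using that[OF w_range] by simp
qed

text \<open>Independence of events on disjoint sets of coordinates, in counting form: a uniformly random
  function agrees with the pattern \<open>w t\<close> on \<open>D t\<close> with probability \<open>1 / card A ^ m\<close>. The induction
  splits a function into its restrictions to \<open>D s\<close> and to the rest of \<open>X\<close>, and therefore needs the
  statement for all \<open>X\<close>. The denominator is multiplied out so as to stay in the natural numbers.\<close>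

lemma card_avoiding_patterns:
  fixes w :: "'i \<Rightarrow> 'x \<Rightarrow> 'b"
  assumes "finite T" "finite A" "finite X" "disjoint_family_on D T"
    and "\<And>t. t \<in> T \<Longrightarrow> D t \<subseteq> X" "\<And>t. t \<in> T \<Longrightarrow> card (D t) = m"
    and "\<And>t. t \<in> T \<Longrightarrow> w t \<in> D t \<rightarrow>\<^sub>E A"
  shows "card {f \<in> X \<rightarrow>\<^sub>E A. \<forall>t\<in>T. \<exists>x\<in>D t. f x \<noteq> w t x} * (card A ^ m) ^ card T
         \<le> (card A ^ m - 1) ^ card T * card A ^ card X"
  using assms
proof (induction T arbitrary: X rule: finite_induct)
  case empty
  then show ?case
    by (simp add: card_funcsetE)
next
  case (insert s T)
  let ?Q = "card A ^ m"
  let ?bad = "\<lambda>X T. {f \<in> X \<rightarrow>\<^sub>E A. \<forall>t\<in>T. \<exists>x\<in>D t. f x \<noteq> w t x}"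
  let ?Y = "X - D s"
  have Ds: "D s \<subseteq> X" "finite (D s)" "card (D s) = m"
    using insert.prems(2,4,5) finite_subset[of "D s" X] by simp_all
  have DT: "D t \<subseteq> ?Y" if "t \<in> T" for t
  proof -
    have "D t \<inter> D s = {}"
      using insert.prems(3) insert.hyps that by (intro disjoint_family_onD[of D "insert s T"]) auto
    moreover have "D t \<subseteq> X"
      using insert.prems(4) that by simp
    ultimately show ?thesis
      by blast
  qed
  have finE: "finite (Y \<rightarrow>\<^sub>E A)" if "finite Y" for Y :: "'x set"
    using insert.prems(1) that by (intro finite_PiE) auto
  have IH: "card (?bad ?Y T) * ?Q ^ card T \<le> (?Q - 1) ^ card T * card A ^ card ?Y"
    using insert.prems DT
    by (intro insert.IH) (auto simp: disjoint_family_on_def)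
  let ?h = "\<lambda>f. (restrict f (D s), restrict f ?Y)"
  have "inj_on ?h (?bad X (insert s T))"
  proof (rule inj_onI)
    fix f g assume f: "f \<in> ?bad X (insert s T)" and g: "g \<in> ?bad X (insert s T)" and eq: "?h f = ?h g"
    show "f = g"
    proof (rule PiE_ext)
      show "f \<in> X \<rightarrow>\<^sub>E A" "g \<in> X \<rightarrow>\<^sub>E A"
        using f g by auto
      show "f x = g x" if "x \<in> X" for x
        using eq that by (metis DiffI prod.inject restrict_apply')
    qed
  qed
  moreover have "?h ` ?bad X (insert s T) \<subseteq> ((D s \<rightarrow>\<^sub>E A) - {w s}) \<times> ?bad ?Y T"
  proof (rule image_subsetI)
    fix f assume f: "f \<in> ?bad X (insert s T)"
    have "restrict f (D s) \<in> D s \<rightarrow>\<^sub>E A" "restrict f ?Y \<in> ?Y \<rightarrow>\<^sub>E A"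
      using f Ds by auto
    moreover have "restrict f (D s) \<noteq> w s"
    proof
      assume eq: "restrict f (D s) = w s"
      obtain x where x: "x \<in> D s" "f x \<noteq> w s x"
        using f by blast
      then show False
        using fun_cong[OF eq, of x] by simp
    qed
    moreover have "\<exists>x\<in>D t. restrict f ?Y x \<noteq> w t x" if t: "t \<in> T" for t
    proof -
      obtain x where "x \<in> D t" "f x \<noteq> w t x"
        using f t by blast
      then show ?thesis
        using DT[OF t] by (intro bexI[of _ x]) auto
    qed
    ultimately show "?h f \<in> ((D s \<rightarrow>\<^sub>E A) - {w s}) \<times> ?bad ?Y T"
      by blast
  qed
  ultimately have "card (?bad X (insert s T)) \<le> card (((D s \<rightarrow>\<^sub>E A) - {w s}) \<times> ?bad ?Y T)"
    using finE[OF Ds(2)] finE[of ?Y] insert.prems(2) by (intro card_inj_on_le) auto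
  also have "\<dots> = (?Q - 1) * card (?bad ?Y T)"
    using insert.prems Ds finE[OF Ds(2)] by (simp add: card_cartesian_product card_funcsetE)
  finally have "card (?bad X (insert s T)) * ?Q ^ card (insert s T)
      \<le> (?Q - 1) * card (?bad ?Y T) * ?Q ^ card (insert s T)"
    by (rule mult_le_mono1)
  also have "\<dots> = (?Q - 1) * ?Q * (card (?bad ?Y T) * ?Q ^ card T)"
    using insert.hyps by simp
  also have "\<dots> \<le> (?Q - 1) * ?Q * ((?Q - 1) ^ card T * card A ^ card ?Y)"
    by (rule mult_le_mono2[OF IH])
  also have "\<dots> = (?Q - 1) ^ card (insert s T) * (?Q * card A ^ card ?Y)"
    using insert.hyps by simp
  also have "?Q * card A ^ card ?Y = card A ^ card X"
  proof -
    have "m + card ?Y = card X"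
      using Ds insert.prems(2) by (metis card_Diff_subset card_mono le_add_diff_inverse)
    then show ?thesis
      by (metis power_add)
  qed
  finally show ?case .
qed

text \<open>Take a maximal packing. Every \<open>k\<close>-subset of \<open>I\<close> then meets some member \<open>f\<close> in at least \<open>s\<close> elements,
  so it arises from \<open>f\<close> by choosing \<open>s\<close> elements of \<open>f\<close> and \<open>k - s\<close> further elements of \<open>I\<close>.\<close>

lemma large_packing_exists:
  assumes I: "finite I" and ks: "s \<le> k"
  obtains T where "T \<subseteq> nsets I k"
    and "\<And>e f. e \<in> T \<Longrightarrow> f \<in> T \<Longrightarrow> e \<noteq> f \<Longrightarrow> card (e \<inter> f) < s"
    and "card I choose k \<le> card T * ((k choose s) * (card I choose (k - s)))"
proof -
  let ?packing = "\<lambda>T. T \<subseteq> nsets I k \<and> (\<forall>e\<in>T. \<forall>f\<in>T. e \<noteq> f \<longrightarrow> card (e \<inter> f) < s)"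
  have finI: "finite (nsets I k)"
    using I by (rule finite_imp_finite_nsets)
  then have "finite {T. ?packing T}"
    by (rule rev_finite_subset[OF finite_Pow_iff[THEN iffD2]]) auto
  then have "\<exists>T \<in> {T. ?packing T}. {} \<subseteq> T \<and> (\<forall>U \<in> {T. ?packing T}. T \<subseteq> U \<longrightarrow> T = U)"
    by (rule finite_has_maximal2) simp
  then obtain T where "T \<in> {T. ?packing T}"
    and max: "\<forall>U \<in> {T. ?packing T}. T \<subseteq> U \<longrightarrow> T = U"
    by (elim bexE conjE)
  then have T: "?packing T"
    by simp
  have maximal: "U = T" if "?packing U" "T \<subseteq> U" for U
    using max[rule_format, of U] that by simp
  let ?ext = "\<lambda>F. {e \<in> nsets I k. F \<subseteq> e}"
  have cover: "nsets I k \<subseteq> (\<Union>f\<in>T. \<Union>F\<in>nsets f s. ?ext F)"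
  proof
    fix e assume e: "e \<in> nsets I k"
    have "\<exists>f\<in>T. s \<le> card (e \<inter> f)"
    proof (cases "e \<in> T")
      case True
      then show ?thesis
        using e ks by (intro bexI[of _ e]) (auto simp: nsets_def)
    next
      case False
      then have "\<not> ?packing (insert e T)"
        using maximal by blast
      then show ?thesis
        using T e by (auto simp: Int_commute not_less)
    qed
    then obtain f where f: "f \<in> T" "s \<le> card (e \<inter> f)"
      by blast
    from f(2) obtain F where F: "F \<subseteq> e \<inter> f" "card F = s" "finite F"
      by (rule obtain_subset_with_card_n)
    then have "F \<in> nsets f s" "e \<in> ?ext F"
      using e by (auto simp: nsets_def)
    then show "e \<in> (\<Union>f\<in>T. \<Union>F\<in>nsets f s. ?ext F)"
      using f by blast
  qed
  have ext: "card (?ext F) \<le> card I choose (k - s)" if F: "finite F" "card F = s" for F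
  proof -
    have "card (?ext F) \<le> card (nsets I (k - s))"
    proof (rule card_inj_on_le)
      show "inj_on (\<lambda>e. e - F) (?ext F)"
        by (auto simp: inj_on_def)
      show "(\<lambda>e. e - F) ` ?ext F \<subseteq> nsets I (k - s)"
        using F by (auto simp: nsets_def card_Diff_subset)
      show "finite (nsets I (k - s))"
        using I by (rule finite_imp_finite_nsets)
    qed
    then show ?thesis
      by simp
  qed
  have finT: "finite T"
    using T finI finite_subset by blast
  have fT: "finite f" "card f = k" if "f \<in> T" for f
    using T that by (auto simp: nsets_def)
  have "card I choose k = card (nsets I k)"
    by simp
  also have "\<dots> \<le> card (\<Union>f\<in>T. \<Union>F\<in>nsets f s. ?ext F)"
    using cover finI finT fT
    by (intro card_mono finite_UN_I finite_imp_finite_nsets) auto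
  also have "\<dots> \<le> (\<Sum>f\<in>T. card (\<Union>F\<in>nsets f s. ?ext F))"
    using finT by (rule card_UN_le)
  also have "\<dots> \<le> (\<Sum>f\<in>T. (k choose s) * (card I choose (k - s)))"
  proof (rule sum_mono)
    fix f assume f: "f \<in> T"
    have "card (\<Union>F\<in>nsets f s. ?ext F) \<le> (\<Sum>F\<in>nsets f s. card (?ext F))"
      using fT[OF f] by (intro card_UN_le finite_imp_finite_nsets) auto
    also have "\<dots> \<le> (\<Sum>F\<in>nsets f s. card I choose (k - s))"
      by (intro sum_mono ext) (auto simp: nsets_def)
    finally show "card (\<Union>F\<in>nsets f s. ?ext F) \<le> (k choose s) * (card I choose (k - s))"
      using fT[OF f] by simp
  qed
  also have "\<dots> = card T * ((k choose s) * (card I choose (k - s)))"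
    by simp
  finally show ?thesis
    using that[of T] T by simp
qed

text \<open>With \<open>s = k - 3\<close> the packing has at least \<open>n choose k\<close> divided by a constant times \<open>n ^ 3\<close> members,
  which is of order \<open>n ^ (k - 3)\<close>.\<close>

lemma packing_size:
  assumes I: "finite I" and k: "3 \<le> k" "k \<le> card I"
  obtains T where "T \<subseteq> nsets I k"
    and "\<And>e f. e \<in> T \<Longrightarrow> f \<in> T \<Longrightarrow> e \<noteq> f \<Longrightarrow> card (e \<inter> f) < k - 3"
    and "real (card I) ^ (k - 3) \<le> real (card T) * (real (k choose (k - 3)) * real k ^ k)"
proof -
  let ?n = "card I"
  obtain T where T: "T \<subseteq> nsets I k"
    "\<And>e f. e \<in> T \<Longrightarrow> f \<in> T \<Longrightarrow> e \<noteq> f \<Longrightarrow> card (e \<inter> f) < k - 3"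
    and size: "?n choose k \<le> card T * ((k choose (k - 3)) * (?n choose (k - (k - 3))))"
    using large_packing_exists[OF I, of "k - 3" k] by (metis diff_le_self)
  have "?n choose 3 \<le> ?n ^ 3"
    using k by (intro binomial_le_pow) simp
  then have "?n choose k \<le> card T * ((k choose (k - 3)) * ?n ^ 3)"
    using size k by (smt (verit) diff_diff_cancel le_trans mult_le_mono2)
  then have le: "real (?n choose k) \<le> real (card T * ((k choose (k - 3)) * ?n ^ 3))"
    by (rule of_nat_mono)
  have "real ?n ^ 3 * real ?n ^ (k - 3) = real ?n ^ k"
    using k by (simp flip: power_add)
  also have "\<dots> = (real ?n / real k) ^ k * real k ^ k"
    using k by (simp add: power_divide)
  also have "\<dots> \<le> real (?n choose k) * real k ^ k"
    using binomial_ge_n_over_k_pow_k[OF k(2), where 'a = real] by (intro mult_right_mono) auto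
  also have "\<dots> \<le> real (card T * ((k choose (k - 3)) * ?n ^ 3)) * real k ^ k"
    using le by (intro mult_right_mono) auto
  also have "\<dots> = real ?n ^ 3 * (real (card T) * (real (k choose (k - 3)) * real k ^ k))"
    by simp
  finally have "real ?n ^ (k - 3) \<le> real (card T) * (real (k choose (k - 3)) * real k ^ k)"
    using k by (subst (asm) mult_le_cancel_left_pos) auto
  then show ?thesis
    using that[OF T] by simp
qed

text \<open>\<open>1 / Q\<close> is the probability that a given \<open>k\<close>-set shows its pattern. Members of the packing share no
  \<open>(k - 3)\<close>-set, so these events depend on disjoint sets of coordinates, and all of them fail with
  probability at most \<open>(1 - 1 / Q) ^ card T \<le> exp (- card T / Q)\<close>.\<close>

lemma few_labellings_with_independent_set:
  assumes V: "finite V" and I: "I \<subseteq> V" "card I = n" and k: "5 \<le> k" "k \<le> n"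
  defines "Q \<equiv> real ((k - 1) ^ ((k choose (k - 3)) * (k - 3)))"
  shows "real (card {c \<in> incidences (k - 3) V \<rightarrow>\<^sub>E {..<k - 1}. independent_set V (coboundary k V c) I})
    \<le> exp (- (real n ^ (k - 3) / (Q * real (k choose (k - 3)) * real k ^ k)))
        * real (card (incidences (k - 3) V \<rightarrow>\<^sub>E {..<k - 1}))"
proof -
  let ?X = "incidences (k - 3) V" and ?D = "incidences (k - 3) :: 'a set \<Rightarrow> _"
  let ?m = "(k choose (k - 3)) * (k - 3)"
  let ?bad = "{c \<in> ?X \<rightarrow>\<^sub>E {..<k - 1}. independent_set V (coboundary k V c) I}"
  have finI: "finite I"
    using I V finite_subset by blast
  obtain T where T: "T \<subseteq> nsets I k"
    and meet: "\<And>e f. e \<in> T \<Longrightarrow> f \<in> T \<Longrightarrow> e \<noteq> f \<Longrightarrow> card (e \<inter> f) < k - 3"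
    and size: "real n ^ (k - 3) \<le> real (card T) * (real (k choose (k - 3)) * real k ^ k)"
    using packing_size[OF finI, of k] I k by auto
  have T': "finite e" "card e = k" "e \<subseteq> I" if "e \<in> T" for e
    using T that by (auto simp: nsets_def)
  have finT: "finite T"
    using T finI finite_imp_finite_nsets finite_subset by blast
  have "\<forall>e\<in>T. \<exists>w. w \<in> ?D e \<rightarrow>\<^sub>E {..<k - 1} \<and>
      (\<forall>c. (\<forall>i \<in> ?D e. c i = w i) \<longrightarrow> odd (card (coherent_subsets k c e)))"
    using T' k by (metis odd_pattern_exists)
  then obtain w where w: "\<And>e. e \<in> T \<Longrightarrow> w e \<in> ?D e \<rightarrow>\<^sub>E {..<k - 1}"
    and odd: "\<And>e c. e \<in> T \<Longrightarrow> (\<forall>i \<in> ?D e. c i = w e i) \<Longrightarrow> odd (card (coherent_subsets k c e))"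
    by metis
  have disj: "disjoint_family_on ?D T"
    unfolding disjoint_family_on_def
  proof (intro ballI impI)
    fix e f assume ef: "e \<in> T" "f \<in> T" "e \<noteq> f"
    show "?D e \<inter> ?D f = {}"
    proof (rule ccontr)
      assume "?D e \<inter> ?D f \<noteq> {}"
      then obtain F where "F \<subseteq> e \<inter> f" "card F = k - 3"
        by (auto simp: incidences_def nsets_def)
      then show False
        using meet[OF ef] T' ef by (metis card_mono finite_Int leD)
    qed
  qed
  let ?avoid = "{c \<in> ?X \<rightarrow>\<^sub>E {..<k - 1}. \<forall>e\<in>T. \<exists>i\<in>?D e. c i \<noteq> w e i}"
  have "?bad \<subseteq> ?avoid"
  proof
    fix c assume c: "c \<in> ?bad"
    have "\<exists>i\<in>?D e. c i \<noteq> w e i" if e: "e \<in> T" for e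
    proof (rule ccontr)
      assume "\<not> ?thesis"
      then have "odd (card (coherent_subsets k c e))"
        using odd[OF e] by blast
      then have "e \<in> induced_edges (coboundary k V c) I"
        using T'[OF e] I by (auto simp: induced_edges_def coboundary_def nsets_def)
      then show False
        using c by (auto simp: independent_set_def)
    qed
    then show "c \<in> ?avoid"
      using c by blast
  qed
  moreover have "finite (?X \<rightarrow>\<^sub>E {..<k - 1})"
    using finite_incidences[OF V] by (intro finite_PiE) auto
  ultimately have "card ?bad \<le> card ?avoid"
    by (intro card_mono) auto
  moreover have "card ?avoid * (card {..<k - 1} ^ ?m) ^ card T
      \<le> (card {..<k - 1} ^ ?m - 1) ^ card T * card {..<k - 1} ^ card ?X"
  proof (rule card_avoiding_patterns[OF finT _ finite_incidences[OF V] disj _ _ w])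
    show "?D e \<subseteq> ?X" if "e \<in> T" for e
      using T'[OF that] I by (auto simp: incidences_def nsets_def)
    show "card (?D e) = ?m" if "e \<in> T" for e
      using T'[OF that] by (simp add: card_incidences)
  qed auto
  ultimately have "card ?bad * ((k - 1) ^ ?m) ^ card T
      \<le> ((k - 1) ^ ?m - 1) ^ card T * card (?X \<rightarrow>\<^sub>E {..<k - 1})"
    using finite_incidences[OF V]
    by (simp add: card_funcsetE) (meson le_trans mult_le_mono1)
  then have "real (card ?bad * ((k - 1) ^ ?m) ^ card T)
      \<le> real (((k - 1) ^ ?m - 1) ^ card T * card (?X \<rightarrow>\<^sub>E {..<k - 1}))"
    by (rule of_nat_mono)
  moreover have Q1: "(k - 1) ^ ?m \<ge> 1" and Q: "Q > 0"
    using k by (auto simp: Q_def)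
  ultimately have "real (card ?bad) * Q ^ card T
      \<le> (Q - 1) ^ card T * real (card (?X \<rightarrow>\<^sub>E {..<k - 1}))"
    unfolding Q_def by (simp add: of_nat_diff)
  then have "real (card ?bad) \<le> ((Q - 1) / Q) ^ card T * real (card (?X \<rightarrow>\<^sub>E {..<k - 1}))"
    using Q by (simp add: power_divide field_simps)
  also have "\<dots> \<le> exp (- (real n ^ (k - 3) / (Q * real (k choose (k - 3)) * real k ^ k)))
        * real (card (?X \<rightarrow>\<^sub>E {..<k - 1}))"
  proof (rule mult_right_mono)
    have "(Q - 1) / Q = 1 + (- 1 / Q)"
      using Q by (simp add: field_simps)
    also have "\<dots> \<le> exp (- 1 / Q)"
      by (rule exp_ge_add_one_self)
    finally have "((Q - 1) / Q) ^ card T \<le> exp (- 1 / Q) ^ card T"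
      using Q1 Q by (intro power_mono divide_nonneg_pos) (simp_all add: Q_def flip: of_nat_power)
    also have "\<dots> = exp (- (real (card T) / Q))"
      by (simp flip: exp_of_nat_mult)
    also have "\<dots> \<le> exp (- (real n ^ (k - 3) / (Q * real (k choose (k - 3)) * real k ^ k)))"
    proof -
      have "real n ^ (k - 3) / (real (k choose (k - 3)) * real k ^ k) \<le> real (card T)"
        using size k by (subst pos_divide_le_eq) auto
      then have "real n ^ (k - 3) / (real (k choose (k - 3)) * real k ^ k) / Q \<le> real (card T) / Q"
        using Q by (intro divide_right_mono) auto
      then show ?thesis
        by (simp add: mult_ac)
    qed
    finally show "((Q - 1) / Q) ^ card T
      \<le> exp (- (real n ^ (k - 3) / (Q * real (k choose (k - 3)) * real k ^ k)))" .
  qed simp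
  finally show ?thesis .
qed

section \<open>The lower bound\<close>

text \<open>The union bound over the \<open>n\<close>-sets. The constant in the exponent is the one from
  \<open>few_labellings_with_independent_set\<close>: the number of \<open>n\<close>-sets is at most \<open>2 powr x\<close> and each is
  independent with probability at most \<open>exp (- x)\<close>, for the same \<open>x > 0\<close>, and \<open>2 < exp 1\<close>.\<close>

lemma not_forces_independent:
  assumes k: "5 \<le> k" "k \<le> n"
  defines "Q \<equiv> real ((k - 1) ^ ((k choose (k - 3)) * (k - 3)))"
  assumes N: "real N \<le> 2 powr (1 / (Q * real (k choose (k - 3)) * real k ^ k) * real n ^ (k - 4))"
  shows "\<not> forces_independent k n N"
proof
  assume forces: "forces_independent k n N"
  define a where "a = 1 / (Q * real (k choose (k - 3)) * real k ^ k)"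
  have a: "a > 0"
    using k by (auto simp: a_def Q_def)
  let ?V = "{..<N}"
  let ?\<Omega> = "incidences (k - 3) ?V \<rightarrow>\<^sub>E {..<k - 1}"
  let ?bad = "\<lambda>I. {c \<in> ?\<Omega>. independent_set ?V (coboundary k ?V c) I}"
  have fin: "finite ?\<Omega>"
    using finite_incidences[of ?V] by (intro finite_PiE) auto
  have "?\<Omega> \<noteq> {}"
    using k by (subst PiE_eq_empty_iff) (auto simp: lessThan_empty_iff)
  then have pos: "card ?\<Omega> > 0"
    using fin by (simp add: card_gt_0_iff)
  have "?\<Omega> \<subseteq> (\<Union>I\<in>nsets ?V n. ?bad I)"
  proof
    fix c assume c: "c \<in> ?\<Omega>"
    have "uniform_hypergraph k ?V (coboundary k ?V c)"
      by (auto simp: uniform_hypergraph_def coboundary_def)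
    moreover have "spans_0_2_4 k ?V (coboundary k ?V c)"
      using k by (intro spans_0_2_4_coboundary) simp
    ultimately obtain I where I: "independent_set ?V (coboundary k ?V c) I" "card I = n"
      using forces unfolding forces_independent_def by (metis card_lessThan)
    then have "I \<in> nsets ?V n"
      by (auto simp: independent_set_def nsets_def intro: finite_subset)
    then show "c \<in> (\<Union>I\<in>nsets ?V n. ?bad I)"
      using I c by blast
  qed
  then have "card ?\<Omega> \<le> card (\<Union>I\<in>nsets ?V n. ?bad I)"
    using fin by (intro card_mono finite_UN_I finite_imp_finite_nsets) auto
  also have "\<dots> \<le> (\<Sum>I\<in>nsets ?V n. card (?bad I))"
    by (intro card_UN_le finite_imp_finite_nsets) simp
  finally have "real (card ?\<Omega>) \<le> (\<Sum>I\<in>nsets ?V n. real (card (?bad I)))"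
    by (simp only: of_nat_sum[symmetric] of_nat_le_iff)
  also have "\<dots> \<le> (\<Sum>I\<in>nsets ?V n. exp (- (a * real n ^ (k - 3))) * real (card ?\<Omega>))"
  proof (rule sum_mono)
    fix I assume "I \<in> nsets ?V n"
    then show "real (card (?bad I)) \<le> exp (- (a * real n ^ (k - 3))) * real (card ?\<Omega>)"
      using few_labellings_with_independent_set[of ?V I n k] k
      by (auto simp: nsets_def a_def Q_def)
  qed
  also have "\<dots> = real (N choose n) * exp (- (a * real n ^ (k - 3))) * real (card ?\<Omega>)"
    by simp
  finally have "1 \<le> real (N choose n) * exp (- (a * real n ^ (k - 3)))"
    using pos by (simp add: mult_le_cancel_right1)
  also have "\<dots> \<le> 2 powr (a * real n ^ (k - 3)) * exp (- (a * real n ^ (k - 3)))"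
  proof (rule mult_right_mono)
    have "N choose n \<le> N ^ n"
      by (cases "n \<le> N") (auto intro: binomial_le_pow simp: binomial_eq_0)
    then have "real (N choose n) \<le> real N ^ n"
      by (metis of_nat_mono of_nat_power)
    also have "\<dots> \<le> (2 powr (a * real n ^ (k - 4))) ^ n"
      using N by (intro power_mono) (auto simp: a_def)
    also have "\<dots> = 2 powr (real n * (a * real n ^ (k - 4)))"
      by (simp add: powr_power mult.commute)
    also have "real n * (a * real n ^ (k - 4)) = a * real n ^ (k - 3)"
    proof -
      have "k - 3 = Suc (k - 4)"
        using k by simp
      then show ?thesis
        by simp
    qed
    finally show "real (N choose n) \<le> 2 powr (a * real n ^ (k - 3))" .
  qed simp
  also have "\<dots> = exp ((ln 2 - 1) * (a * real n ^ (k - 3)))"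
    by (simp add: powr_def algebra_simps flip: exp_add)
  also have "\<dots> < 1"
  proof -
    have "ln 2 - 1 < (0::real)"
      using ln_2_less_1 by simp
    moreover have "a * real n ^ (k - 3) > 0"
      using a k by auto
    ultimately show ?thesis
      by (simp add: mult_neg_pos)
  qed
  finally show False
    by simp
qed

text \<open>The bound on the number of vertices covers every \<open>N\<close> up to \<open>2 powr (c * n ^ (k - 4))\<close>, so it may
  be applied to \<open>N = ramsey_g k n\<close> itself, which forces an independent set because the minimum is
  attained.\<close>

theorem theorem1p2:
  fixes k :: nat
  assumes "k \<ge> 5"
  shows "\<exists>c::real. c > 0 \<and> (\<forall>n::nat. n \<ge> k \<longrightarrow> real (ramsey_g k n) > 2 powr (c * real n ^ (k - 4)))"
proof -
  define Q where "Q = real ((k - 1) ^ ((k choose (k - 3)) * (k - 3)))"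
  define c where "c = 1 / (Q * real (k choose (k - 3)) * real k ^ k)"
  have "c > 0"
    using assms by (auto simp: c_def Q_def)
  moreover have "real (ramsey_g k n) > 2 powr (c * real n ^ (k - 4))" if n: "n \<ge> k" for n
  proof (rule ccontr)
    assume "\<not> ?thesis"
    then have "\<not> forces_independent k n (ramsey_g k n)"
      using assms n by (intro not_forces_independent) (auto simp: c_def Q_def)
    moreover have "forces_independent k n (ramsey_g k n)"
      unfolding ramsey_g_def using forces_independent_exists[OF assms] by (rule LeastI_ex)
    ultimately show False
      by blast
  qed
  ultimately show ?thesis
    by blast
qed

end
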